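(* Let $1\le p<\infty$, and let $u:\mathbb{N}\to\mathbb{C}$ and $\phi:\mathbb{N}\to\mathbb{N}$ be such that $uC_\phi$ is a bounded linear operator on $\ell_p$ and the range $\mathcal{R}(uC_\phi)$ is closed. If $\{n\in\mathbb{N}: |\phi^{-1}(n)\cap S(u)|>1\}$ is a finite set, then $\mathcal{R}(uC_\phi)$ is a complemented subspace of $\ell_p$.
   Context: $\mathbb{N}$ is the set of positive integers; $\ell_p$ is the Banach space of $p$-summable complex sequences, viewed as functions on $\mathbb{N}$. The operator $uC_\phi$ is defined by $uC_\phi(f)=u\cdot(f\circ\phi)$, i.e. $(uC_\phi f)(m)=u(m)f(\phi(m))$. $\mathcal{R}(T)$ is the range of $T$; $S(u)=\{n\in\mathbb{N}: u(n)\ne 0\}$; $|A|$ is the cardinality of $A$; $\phi^{-1}(n)=\{m\in\mathbb{N}:\phi(m)=n\}$. A closed subspace $E$ of a Banach space $X$ is complemented if there is a closed subspace $F\subseteq X$ with $E\oplus F=X$. *)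

theory Defs
  imports "HOL-Analysis.Analysis" "HOL-Library.Function_Algebras"
begin

typedef pnat = "{n :: nat. 0 < n}"
  by (rule exI[of _ 1]) simp

text \<open>The index type is arbitrary here; the classical \<open>\<ell>\<^sub>p\<close> is the case of the index
  type \<^typ>\<open>pnat\<close>. Addition, zero and subtraction of functions are the pointwise ones from
  \<^theory>\<open>HOL-Library.Function_Algebras\<close>.\<close>

definition lp :: "real \<Rightarrow> ('i \<Rightarrow> complex) set" where
  "lp p = {f. (\<lambda>i. norm (f i) powr p) summable_on UNIV}"

definition lp_norm :: "real \<Rightarrow> ('i \<Rightarrow> complex) \<Rightarrow> real" where
  "lp_norm p f = (\<Sum>\<^sub>\<infinity>i. norm (f i) powr p) powr (1 / p)"

definition lp_dist :: "real \<Rightarrow> ('i \<Rightarrow> complex) \<Rightarrow> ('i \<Rightarrow> complex) \<Rightarrow> real" where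
  "lp_dist p f g = lp_norm p (f - g)"

definition lp_topology :: "real \<Rightarrow> ('i \<Rightarrow> complex) topology" where
  "lp_topology p = Metric_space.mtopology (lp p) (lp_dist p)"

definition cscale :: "complex \<Rightarrow> ('i \<Rightarrow> complex) \<Rightarrow> ('i \<Rightarrow> complex)" where
  "cscale c f = (\<lambda>i. c * f i)"

interpretation cfun: vector_space cscale
  by unfold_locales (auto simp: cscale_def algebra_simps fun_eq_iff)

definition bounded_linear_lp :: "real \<Rightarrow> (('i \<Rightarrow> complex) \<Rightarrow> ('i \<Rightarrow> complex)) \<Rightarrow> bool" where
  "bounded_linear_lp p T \<longleftrightarrow>
     (\<forall>f\<in>lp p. T f \<in> lp p) \<and>
     (\<forall>f\<in>lp p. \<forall>g\<in>lp p. T (f + g) = T f + T g) \<and>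
     (\<forall>c. \<forall>f\<in>lp p. T (cscale c f) = cscale c (T f)) \<and>
     (\<exists>K. \<forall>f\<in>lp p. lp_norm p (T f) \<le> K * lp_norm p f)"

text \<open>A set that is closed in \<^term>\<open>lp_topology p\<close> is in particular contained in \<^term>\<open>lp p\<close>.\<close>

definition closed_subspace_lp :: "real \<Rightarrow> ('i \<Rightarrow> complex) set \<Rightarrow> bool" where
  "closed_subspace_lp p E \<longleftrightarrow> cfun.subspace E \<and> closedin (lp_topology p) E"

definition complemented_lp :: "real \<Rightarrow> ('i \<Rightarrow> complex) set \<Rightarrow> bool" where
  "complemented_lp p E \<longleftrightarrow> closed_subspace_lp p E \<and>
     (\<exists>F. closed_subspace_lp p F \<and> E \<inter> F = {0} \<and> {e + f | e f. e \<in> E \<and> f \<in> F} = lp p)"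

definition weighted_comp :: "('i \<Rightarrow> complex) \<Rightarrow> ('i \<Rightarrow> 'i) \<Rightarrow> ('i \<Rightarrow> complex) \<Rightarrow> ('i \<Rightarrow> complex)" where
  "weighted_comp u \<phi> f = (\<lambda>m. u m * f (\<phi> m))"

definition lp_range :: "real \<Rightarrow> (('i \<Rightarrow> complex) \<Rightarrow> ('i \<Rightarrow> complex)) \<Rightarrow> ('i \<Rightarrow> complex) set" where
  "lp_range p T = T ` lp p"

definition nonzero_set :: "('i \<Rightarrow> complex) \<Rightarrow> 'i set" where
  "nonzero_set u = {n. u n \<noteq> 0}"

text \<open>Since \<^const>\<open>card\<close> is 0 on infinite sets, these have to be included explicitly.\<close>

definition card_gt_one :: "'a set \<Rightarrow> bool" where
  "card_gt_one A \<longleftrightarrow> infinite A \<or> 1 < card A"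


text \<open>Well-definedness of the topology: \<^const>\<open>lp_dist\<close> is a metric on \<^term>\<open>lp p\<close>
  (Minkowski's inequality).\<close>

lemma powr_convex_nonneg:
  fixes p t x y :: real
  assumes "1 \<le> p" "0 < t" "t < 1" "0 \<le> x" "0 \<le> y"
  shows "(t * x + (1 - t) * y) powr p \<le> t * x powr p + (1 - t) * y powr p"
proof -
  have le: "s powr p \<le> s" if "0 < s" "s < 1" for s :: real
    using powr_mono'[of 1 p s] that assms(1) by simp
  consider "x = 0" | "y = 0" | "0 < x" "0 < y"
    using assms by linarith
  then show ?thesis
  proof cases
    case 1
    then show ?thesis using le[of "1 - t"] assms
      by (simp add: powr_mult mult_right_mono)
  next
    case 2
    then show ?thesis using le[of t] assms
      by (simp add: powr_mult mult_right_mono)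
  next
    case 3
    then show ?thesis
      using convex_onD[OF powr_convex[OF assms(1)], of "1 - t" x y] assms by simp
  qed
qed

lemma lp_norm_nonneg [simp]: "0 \<le> lp_norm p f"
  by (simp add: lp_norm_def)

lemma lp_norm_powr:
  assumes "1 \<le> p"
  shows "lp_norm p f powr p = (\<Sum>\<^sub>\<infinity>i. norm (f i) powr p)"
  using assms by (simp add: lp_norm_def powr_powr infsum_nonneg)

lemma lp_norm_eq_0_iff:
  assumes "1 \<le> p" "f \<in> lp p"
  shows "lp_norm p f = 0 \<longleftrightarrow> f = 0"
proof
  assume "lp_norm p f = 0"
  then have 0: "(\<Sum>\<^sub>\<infinity>i. norm (f i) powr p) = 0"
    by (simp add: lp_norm_def)
  have "norm (f i) powr p = 0" for i
    by (rule nonneg_infsum_le_0D[of _ UNIV]) (use 0 assms in \<open>auto simp: lp_def\<close>)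
  then show "f = 0" by (auto simp: fun_eq_iff)
qed (simp add: lp_norm_def)

lemma lp_minkowski:
  assumes p: "1 \<le> p" and f: "f \<in> lp p" and g: "g \<in> lp p"
  shows "f + g \<in> lp p" and "lp_norm p (f + g) \<le> lp_norm p f + lp_norm p g"
proof -
  have "f + g \<in> lp p \<and> lp_norm p (f + g) \<le> lp_norm p f + lp_norm p g"
  proof (cases "lp_norm p f = 0 \<or> lp_norm p g = 0")
    case True
    then have "f = 0 \<or> g = 0" using lp_norm_eq_0_iff p f g by blast
    then show ?thesis using f g by auto
  next
    case False
    define A B where "A = lp_norm p f" and "B = lp_norm p g"
    have AB: "0 < A" "0 < B"
      using False lp_norm_nonneg[of p f] lp_norm_nonneg[of p g]
      unfolding A_def B_def by linarith+
    define t where "t = A / (A + B)"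
    have t: "0 < t" "t < 1" and t': "1 - t = B / (A + B)"
      using AB by (auto simp: t_def field_simps)
    define a b where "a = (A + B) powr p * t / A powr p"
      and "b = (A + B) powr p * (1 - t) / B powr p"
    have pw: "norm ((f + g) i) powr p \<le> a * norm (f i) powr p + b * norm (g i) powr p" for i
    proof -
      have "norm ((f + g) i) \<le> norm (f i) + norm (g i)"
        by (simp add: norm_triangle_ineq)
      also have "\<dots> = (A + B) * (t * (norm (f i) / A) + (1 - t) * (norm (g i) / B))"
      proof -
        have "(A + B) * (t * x / A) = x" for x :: real
          using AB by (simp add: t_def)
        moreover have "(A + B) * ((1 - t) * y / B) = y" for y :: real
          using AB by (simp add: t')
        ultimately show ?thesis by (simp add: distrib_left)
      qed
      finally have "norm ((f + g) i) powr p \<le> \<dots> powr p"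
        using p by (intro powr_mono2) auto
      also have "\<dots> = (A + B) powr p * (t * (norm (f i) / A) + (1 - t) * (norm (g i) / B)) powr p"
        using AB t by (intro powr_mult)
      also have "\<dots> \<le> (A + B) powr p *
          (t * (norm (f i) / A) powr p + (1 - t) * (norm (g i) / B) powr p)"
        using AB t p by (intro mult_left_mono powr_convex_nonneg) auto
      also have "\<dots> = a * norm (f i) powr p + b * norm (g i) powr p"
        using AB by (simp add: a_def b_def powr_divide algebra_simps)
      finally show ?thesis .
    qed
    have sf: "(\<lambda>i. a * norm (f i) powr p) summable_on UNIV"
      and sg: "(\<lambda>i. b * norm (g i) powr p) summable_on UNIV"
      using f g by (auto simp: lp_def intro: summable_on_cmult_right)
    note s = summable_on_add[OF sf sg]
    have sfg: "(\<lambda>i. norm ((f + g) i) powr p) summable_on UNIV"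
      by (rule summable_on_comparison_test[OF s]) (use pw in auto)
    have "(\<Sum>\<^sub>\<infinity>i. norm ((f + g) i) powr p)
        \<le> (\<Sum>\<^sub>\<infinity>i. a * norm (f i) powr p + b * norm (g i) powr p)"
      by (rule infsum_mono[OF sfg s]) (rule pw)
    also have "\<dots> = a * A powr p + b * B powr p"
      unfolding A_def B_def lp_norm_powr[OF p]
      by (simp add: infsum_add[OF sf sg] infsum_cmult_right')
    also have "\<dots> = (A + B) powr p * t + (A + B) powr p * (1 - t)"
      using AB by (simp add: a_def b_def)
    also have "\<dots> = (A + B) powr p"
      by (simp add: algebra_simps)
    finally have "lp_norm p (f + g) \<le> ((A + B) powr p) powr (1 / p)"
      unfolding lp_norm_def using p by (intro powr_mono2) (auto intro: infsum_nonneg)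
    also have "\<dots> = A + B"
      using AB p by (simp add: powr_powr)
    finally show ?thesis using sfg by (simp add: lp_def A_def B_def)
  qed
  then show "f + g \<in> lp p" "lp_norm p (f + g) \<le> lp_norm p f + lp_norm p g" by auto
qed

lemma lp_uminus: "f \<in> lp p \<Longrightarrow> - f \<in> lp p"
  by (simp add: lp_def)

lemma lp_diff:
  assumes "1 \<le> p" "f \<in> lp p" "g \<in> lp p"
  shows "f - g \<in> lp p"
  using lp_minkowski(1)[OF assms(1,2) lp_uminus[OF assms(3)]] by simp

lemma Metric_space_lp:
  assumes p: "1 \<le> p"
  shows "Metric_space (lp p) (lp_dist p)"
proof
  fix f g h :: "'i \<Rightarrow> complex"
  show "0 \<le> lp_dist p f g" by (simp add: lp_dist_def)
  show "lp_dist p f g = lp_dist p g f"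
    by (simp add: lp_dist_def lp_norm_def norm_minus_commute)
  assume f: "f \<in> lp p" and g: "g \<in> lp p"
  show "lp_dist p f g = 0 \<longleftrightarrow> f = g"
    using lp_norm_eq_0_iff[OF p lp_diff[OF p f g]] by (simp add: lp_dist_def)
  assume h: "h \<in> lp p"
  show "lp_dist p f h \<le> lp_dist p f g + lp_dist p g h"
    using lp_minkowski(2)[OF p lp_diff[OF p f g] lp_diff[OF p g h]] by (simp add: lp_dist_def)
qed

end

theory Submission
  imports Defs
begin

text \<open>For every \<open>n\<close> in \<open>\<phi>(S(u))\<close> choose a point \<open>s(n)\<close> of \<open>S(u)\<close> in the fibre over \<open>n\<close>. A complement
  of the range is the closed space \<open>F\<close> of all \<open>g\<close> that vanish at the points \<open>s(n)\<close>. The projection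
  along \<open>F\<close> is \<open>g \<mapsto> u \<cdot> (h \<circ> \<phi>)\<close> with \<open>h(n) = g(s(n)) / u(s(n))\<close>. It maps into \<open>\<ell>\<^sub>p\<close>: over the
  fibres that meet \<open>S(u)\<close> in one point it only restricts \<open>g\<close>, and the finitely many remaining
  fibres contribute multiples of the images of unit vectors. It is not clear
  that \<open>h\<close> is in \<open>\<ell>\<^sub>p\<close>, but \<open>u \<cdot> (h \<circ> \<phi>)\<close> is the limit of the images of the finite truncations of
  \<open>h\<close>, so it lies in the range because the range is closed.\<close>

lemma lp_dominated:
  assumes "1 \<le> p" "g \<in> lp p" "\<And>i. norm (f i) \<le> norm (g i)"
  shows "f \<in> lp p"
  unfolding lp_def mem_Collect_eq
  by (rule summable_on_comparison_test[of "\<lambda>i. norm (g i) powr p"])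
    (use assms in \<open>auto simp: lp_def intro!: powr_mono2\<close>)

lemma lp_finite_support:
  assumes "finite A" "\<And>i. i \<notin> A \<Longrightarrow> f i = 0"
  shows "f \<in> lp p"
proof -
  have "(\<lambda>i. norm (f i) powr p) summable_on A \<longleftrightarrow> (\<lambda>i. norm (f i) powr p) summable_on UNIV"
    by (rule summable_on_cong_neutral) (use assms in auto)
  then show ?thesis using assms by (simp add: lp_def)
qed

lemma lp_cscale: "f \<in> lp p \<Longrightarrow> cscale c f \<in> lp p"
  by (simp add: lp_def cscale_def norm_mult powr_mult summable_on_cmult_right)

lemma subspace_lp: "1 \<le> p \<Longrightarrow> cfun.subspace (lp p)"
  unfolding cfun.subspace_def
  by (auto simp: lp_cscale lp_minkowski(1) intro: lp_finite_support[of "{}"])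

text \<open>A single term of a sum of nonnegative terms is at most the sum. This makes evaluation at
  \<open>i\<close> continuous on \<open>lp p\<close>.\<close>

lemma norm_le_lp_norm:
  assumes p: "1 \<le> p" and f: "f \<in> lp p"
  shows "norm (f i) \<le> lp_norm p f"
proof -
  have "norm (f i) powr p = (\<Sum>\<^sub>\<infinity>j\<in>{i}. norm (f j) powr p)" by simp
  also have "\<dots> \<le> (\<Sum>\<^sub>\<infinity>j. norm (f j) powr p)"
    by (rule infsum_mono2) (use f in \<open>auto simp: lp_def\<close>)
  finally have "(norm (f i) powr p) powr (1 / p) \<le> lp_norm p f"
    unfolding lp_norm_def using p by (intro powr_mono2) auto
  then show ?thesis using p by (simp add: powr_powr)
qed

text \<open>Finite partial sums of the \<open>p\<close>-th powers converge, so the mass outside a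
  suitable finite \<open>K\<close> is below \<open>e powr p\<close>. The bound is needed for every
  \<open>L\<close> containing \<open>K\<close>, since it is later applied to a union of fibres,
  which may be infinite.\<close>

lemma lp_norm_tail:
  fixes g :: "'i \<Rightarrow> complex"
  assumes p: "1 \<le> p" and g: "g \<in> lp p" and e: "0 < e"
  obtains K where "finite K"
    "\<And>L. K \<subseteq> L \<Longrightarrow> lp_norm p (\<lambda>i. if i \<in> L then 0 else g i) < e"
proof -
  let ?n = "\<lambda>i. norm (g i) powr p"
  have s: "?n summable_on UNIV" using g by (simp add: lp_def)
  have "\<forall>\<^sub>F K in finite_subsets_at_top UNIV. dist (sum ?n K) (infsum ?n UNIV) < e powr p"
    using has_sum_infsum[OF s] e unfolding has_sum_def by (intro tendstoD) auto
  then obtain K where K: "finite K" "dist (sum ?n K) (infsum ?n UNIV) < e powr p"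
    unfolding eventually_finite_subsets_at_top by auto
  show thesis
  proof (rule that[OF K(1)])
    fix L assume L: "K \<subseteq> L"
    let ?t = "\<lambda>i. if i \<in> L then 0 else g i"
    have st: "(\<lambda>i. norm (?t i) powr p) summable_on UNIV"
      using lp_dominated[OF p g, of ?t] by (simp add: lp_def)
    have sK: "?n summable_on (UNIV - K)"
      by (rule summable_on_subset_banach[OF s]) auto
    have "(\<Sum>\<^sub>\<infinity>i. norm (?t i) powr p) \<le> infsum ?n (UNIV - K)"
      by (rule infsum_mono_neutral[OF st sK]) (use L in auto)
    also have "\<dots> = infsum ?n UNIV - sum ?n K"
      using infsum_Diff[OF s, of K] K(1) by simp
    also have "\<dots> < e powr p"
      using K(2) by (simp add: dist_real_def)
    finally have "lp_norm p ?t < (e powr p) powr (1 / p)"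
      unfolding lp_norm_def using p by (intro powr_less_mono2) (auto intro: infsum_nonneg)
    then show "lp_norm p ?t < e" using p e by (simp add: powr_powr)
  qed
qed

lemma closedin_lp_topology_iff:
  assumes "1 \<le> p"
  shows "closedin (lp_topology p) C \<longleftrightarrow>
    C \<subseteq> lp p \<and> (\<forall>f\<in>lp p. (\<forall>e>0. \<exists>g\<in>C. lp_norm p (f - g) < e) \<longrightarrow> f \<in> C)"
proof -
  interpret Metric_space "lp p :: ('a \<Rightarrow> complex) set" "lp_dist p" by (rule Metric_space_lp[OF assms])
  show ?thesis
    unfolding lp_topology_def closedin_metric disjnt_iff in_mball lp_dist_def subset_iff
    by (meson DiffD1 DiffD2 DiffI)
qed

lemma closed_subspace_lp_vanishing:
  assumes p: "1 \<le> p"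
  shows "closed_subspace_lp p {f \<in> lp p. \<forall>i\<in>A. f i = 0}"
  unfolding closed_subspace_lp_def
proof
  show "cfun.subspace {f \<in> lp p. \<forall>i\<in>A. f i = 0}"
    using subspace_lp[OF p] by (auto simp: cfun.subspace_def) (simp add: cscale_def)
  show "closedin (lp_topology p) {f \<in> lp p. \<forall>i\<in>A. f i = 0}"
    unfolding closedin_lp_topology_iff[OF p]
  proof (intro conjI ballI impI CollectI)
    fix f i
    assume f: "f \<in> lp p" and i: "i \<in> A"
      and app: "\<forall>e>0. \<exists>g\<in>{f \<in> lp p. \<forall>i\<in>A. f i = 0}. lp_norm p (f - g) < e"
    show "f i = 0"
    \<comment> \<open>Approximating within \<open>norm (f i)\<close> is already absurd:
      \<open>g i = 0\<close>, so \<open>f - g\<close> has the value \<open>f i\<close> at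
      \<open>i\<close>.\<close>
    proof (rule ccontr)
      assume "f i \<noteq> 0"
      then obtain g where g: "g \<in> lp p" "g i = 0" "lp_norm p (f - g) < norm (f i)"
        using app i by (metis (mono_tags, lifting) mem_Collect_eq zero_less_norm_iff)
      then show False
        using norm_le_lp_norm[OF p lp_diff[OF p f g(1)], of i] by simp
    qed
  qed auto
qed

lemma lp_range_subset: "bounded_linear_lp p T \<Longrightarrow> lp_range p T \<subseteq> lp p"
  by (auto simp: bounded_linear_lp_def lp_range_def)

lemma subspace_lp_range:
  assumes p: "1 \<le> p" and T: "bounded_linear_lp p T"
  shows "cfun.subspace (lp_range p T)"
proof -
  note lin = T[unfolded bounded_linear_lp_def]
  note sub = subspace_lp[OF p, unfolded cfun.subspace_def]
  \<comment> \<open>\<open>T\<close> is linear only on \<open>lp p\<close>, so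
    \<open>T 0 = 0\<close> is derived from homogeneity with factor 0.\<close>
  have "T (cscale 0 0) = cscale 0 (T 0)" using lin sub by blast
  then have "T 0 = 0" by (simp add: cscale_def zero_fun_def)
  then have "0 \<in> lp_range p T" using sub unfolding lp_range_def by (metis image_eqI)
  moreover have "x + y \<in> lp_range p T" if xy: "x \<in> lp_range p T" "y \<in> lp_range p T" for x y
  proof -
    obtain f g where "f \<in> lp p" "x = T f" "g \<in> lp p" "y = T g"
      using xy by (auto simp: lp_range_def)
    moreover from this have "x + y = T (f + g)" using lin by simp
    ultimately show ?thesis using sub by (auto simp: lp_range_def)
  qed
  moreover have "cscale c x \<in> lp_range p T" if x: "x \<in> lp_range p T" for c x
  proof -
    obtain f where "f \<in> lp p" "x = T f"
      using x by (auto simp: lp_range_def)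
    moreover from this have "cscale c x = T (cscale c f)" using lin by simp
    ultimately show ?thesis using sub by (auto simp: lp_range_def)
  qed
  ultimately show ?thesis unfolding cfun.subspace_def by blast
qed

lemma weighted_comp_in_closed_range:
  assumes p: "1 \<le> p"
    and closed: "closedin (lp_topology p) (lp_range p (weighted_comp u \<phi>))"
    and h: "weighted_comp u \<phi> h \<in> lp p"
  shows "weighted_comp u \<phi> h \<in> lp_range p (weighted_comp u \<phi>)"
proof -
  have "\<exists>g\<in>lp_range p (weighted_comp u \<phi>). lp_norm p (weighted_comp u \<phi> h - g) < e"
    if e: "0 < e" for e
  proof -
    obtain K where K: "finite K"
      "\<And>L. K \<subseteq> L \<Longrightarrow> lp_norm p (\<lambda>i. if i \<in> L then 0 else weighted_comp u \<phi> h i) < e"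
      using lp_norm_tail[OF p h e] by blast
    define f where "f = (\<lambda>n. if n \<in> \<phi> ` K then h n else 0)"
    have "f \<in> lp p"
      by (rule lp_finite_support[of "\<phi> ` K"]) (use K(1) in \<open>auto simp: f_def\<close>)
    moreover have "weighted_comp u \<phi> h - weighted_comp u \<phi> f =
        (\<lambda>i. if i \<in> \<phi> -` \<phi> ` K then 0 else weighted_comp u \<phi> h i)"
      by (auto simp: weighted_comp_def f_def fun_eq_iff)
    moreover have "lp_norm p (\<lambda>i. if i \<in> \<phi> -` \<phi> ` K then 0 else weighted_comp u \<phi> h i) < e"
      by (rule K(2)) auto
    ultimately show ?thesis
      unfolding lp_range_def by (intro bexI[of _ "weighted_comp u \<phi> f"]) simp_all
  qed
  then show ?thesis
    using closed h unfolding closedin_lp_topology_iff[OF p] by blast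
qed

lemma not_card_gt_oneD: "\<not> card_gt_one A \<Longrightarrow> x \<in> A \<Longrightarrow> y \<in> A \<Longrightarrow> x = y"
  by (auto simp: card_gt_one_def card_le_Suc0_iff_eq not_less)

text \<open>The function splits over \<open>J\<close>, the set of \<open>n\<close> whose fibre meets
  the support of \<open>u\<close> more than once. Off \<open>J\<close> it is dominated by
  \<open>g\<close>; on \<open>J\<close> it is the image of a finitely supported function.\<close>

lemma weighted_comp_section_in_lp:
  assumes p: "1 \<le> p"
    and T: "bounded_linear_lp p (weighted_comp u \<phi>)"
    and fin: "finite {n. card_gt_one (\<phi> -` {n} \<inter> nonzero_set u)}"
    and s: "\<And>n. n \<in> \<phi> ` nonzero_set u \<Longrightarrow> s n \<in> \<phi> -` {n} \<inter> nonzero_set u"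
    and g: "g \<in> lp p"
  shows "weighted_comp u \<phi> (\<lambda>n. g (s n) / u (s n)) \<in> lp p"
proof -
  define J where "J = {n. card_gt_one (\<phi> -` {n} \<inter> nonzero_set u)}"
  have J: "finite J" using fin by (simp add: J_def)
  define h where "h = (\<lambda>n. g (s n) / u (s n))"
  define g0 where "g0 = (\<lambda>m. if u m \<noteq> 0 \<and> \<phi> m \<notin> J then g m else 0)"
  define k where "k = (\<lambda>n. if n \<in> J then h n else 0)"
  have single: "s (\<phi> m) = m" if "u m \<noteq> 0" "\<phi> m \<notin> J" for m
    by (rule not_card_gt_oneD[of "\<phi> -` {\<phi> m} \<inter> nonzero_set u"])
      (use that s[of "\<phi> m"] in \<open>auto simp: J_def nonzero_set_def\<close>)
  have "weighted_comp u \<phi> h = g0 + weighted_comp u \<phi> k"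
    by (auto simp: fun_eq_iff weighted_comp_def g0_def k_def h_def single)
  moreover have "g0 \<in> lp p"
    by (rule lp_dominated[OF p g]) (simp add: g0_def)
  moreover have "weighted_comp u \<phi> k \<in> lp p"
  proof -
    have "k \<in> lp p" by (rule lp_finite_support[OF J]) (simp add: k_def)
    then show ?thesis using T by (simp add: bounded_linear_lp_def)
  qed
  ultimately show ?thesis using lp_minkowski(1)[OF p] by (simp add: h_def)
qed

lemma complemented_lp_range_weighted_comp:
  assumes p: "1 \<le> p"
    and T: "bounded_linear_lp p (weighted_comp u \<phi>)"
    and closed: "closedin (lp_topology p) (lp_range p (weighted_comp u \<phi>))"
    and fin: "finite {n. card_gt_one (\<phi> -` {n} \<inter> nonzero_set u)}"
  shows "complemented_lp p (lp_range p (weighted_comp u \<phi>))"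
proof -
  let ?E = "lp_range p (weighted_comp u \<phi>)"
  let ?N = "\<phi> ` nonzero_set u"
  have "\<forall>n\<in>?N. \<exists>m. m \<in> \<phi> -` {n} \<inter> nonzero_set u" by auto
  then obtain s where s: "\<And>n. n \<in> ?N \<Longrightarrow> s n \<in> \<phi> -` {n} \<inter> nonzero_set u"
    by metis
  define F where "F = {f \<in> lp p. \<forall>i \<in> s ` ?N. f i = 0}"
  have subE: "cfun.subspace ?E" by (rule subspace_lp_range[OF p T])
  have clF: "closed_subspace_lp p F"
    unfolding F_def by (rule closed_subspace_lp_vanishing[OF p])
  have "?E \<inter> F \<subseteq> {0}"
  proof
    fix x assume x: "x \<in> ?E \<inter> F"
    then obtain f where f: "x = weighted_comp u \<phi> f" by (auto simp: lp_range_def)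
    \<comment> \<open>One zero per fibre suffices: \<open>x\<close> vanishes at
      \<open>s (\<phi> m)\<close>, where \<open>u\<close> does not, so
      \<open>f (\<phi> m) = 0\<close> and \<open>x\<close> is zero on the whole fibre.\<close>
    have "x m = 0" for m
    proof (cases "u m = 0")
      case False
      then have n: "\<phi> m \<in> ?N" by (auto simp: nonzero_set_def)
      then have "x (s (\<phi> m)) = 0" using x by (auto simp: F_def)
      then have "f (\<phi> m) = 0"
        using s[OF n] by (simp add: f weighted_comp_def nonzero_set_def)
      then show ?thesis by (simp add: f weighted_comp_def)
    qed (simp add: f weighted_comp_def)
    then show "x \<in> {0}" by (simp add: fun_eq_iff)
  qed
  moreover have "0 \<in> ?E \<inter> F"
    using subE clF by (simp add: closed_subspace_lp_def cfun.subspace_0)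
  moreover have "{e + f | e f. e \<in> ?E \<and> f \<in> F} = lp p"
  proof
    show "{e + f | e f. e \<in> ?E \<and> f \<in> F} \<subseteq> lp p"
      using lp_range_subset[OF T] lp_minkowski(1)[OF p] by (auto simp: F_def)
    show "lp p \<subseteq> {e + f | e f. e \<in> ?E \<and> f \<in> F}"
    proof
      fix g :: "'a \<Rightarrow> complex" assume g: "g \<in> lp p"
      define e where "e = weighted_comp u \<phi> (\<lambda>n. g (s n) / u (s n))"
      have e: "e \<in> lp p"
        unfolding e_def by (rule weighted_comp_section_in_lp[OF p T fin s g])
      then have "e \<in> ?E"
        unfolding e_def by (rule weighted_comp_in_closed_range[OF p closed])
      moreover have "g - e \<in> F"
      proof -
        \<comment> \<open>Since \<open>\<phi> (s n) = n\<close>, the factor \<open>u (s n)\<close>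
          cancels the denominator.\<close>
        have "e (s n) = g (s n)" if "n \<in> ?N" for n
          using s[OF that] by (simp add: e_def weighted_comp_def nonzero_set_def)
        then show ?thesis using lp_diff[OF p g e] by (simp add: F_def)
      qed
      moreover have "g = e + (g - e)" by simp
      ultimately show "g \<in> {e + f | e f. e \<in> ?E \<and> f \<in> F}" by blast
    qed
  qed
  ultimately show ?thesis
    using subE closed clF unfolding complemented_lp_def closed_subspace_lp_def by blast
qed

theorem theorem3p7:
  fixes p :: real and u :: "pnat \<Rightarrow> complex" and \<phi> :: "pnat \<Rightarrow> pnat"
  assumes "1 \<le> p"
    and "bounded_linear_lp p (weighted_comp u \<phi>)"
    and "closedin (lp_topology p) (lp_range p (weighted_comp u \<phi>))"
    and "finite {n. card_gt_one (\<phi> -` {n} \<inter> nonzero_set u)}"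
  shows "complemented_lp p (lp_range p (weighted_comp u \<phi>))"
  using assms by (rule complemented_lp_range_weighted_comp)

end
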